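(* For all integers $t\geq 5$ and $k$ with $t\leq k\leq t+1$, $$\operatorname{bgr}_k(K_{1,3}:K_{1,t})=t+1.$$
   Context: All graphs are finite, simple and undirected. $K_{a,b}$ denotes the complete bipartite graph with parts of sizes $a$ and $b$. A $k$-edge-coloring (not necessarily proper) is exact if all $k$ colors are used at least once. A copy of a graph in an edge-colored graph is a (not necessarily induced) subgraph isomorphic to it; it is rainbow if no two of its edges have the same color and monochromatic if all its edges have the same color. The $k$-colored bipartite Gallai-Ramsey number $\operatorname{bgr}_k(G:H)$ is the minimum integer $n$ such that $n^2\geq k$ and for every $N\geq n$, every exact $k$-edge-coloring of the complete bipartite graph $K_{N,N}$ contains either a rainbow copy of $G$ or a monochromatic copy of $H$. *)

theory Defs
  imports "HOL-Library.Extended_Nat"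
begin

record 'a ugraph =
  verts :: "'a set"
  edges :: "'a set set"

definition simple_graph :: "'a ugraph \<Rightarrow> bool" where
  "simple_graph G \<longleftrightarrow>
     finite (verts G) \<and> (\<forall>e\<in>edges G. e \<subseteq> verts G \<and> card e = 2)"

definition subgraph :: "'a ugraph \<Rightarrow> 'a ugraph \<Rightarrow> bool" where
  "subgraph S F \<longleftrightarrow> simple_graph S \<and> verts S \<subseteq> verts F \<and> edges S \<subseteq> edges F"

definition isomorphic :: "'a ugraph \<Rightarrow> 'b ugraph \<Rightarrow> bool" where
  "isomorphic G H \<longleftrightarrow>
     (\<exists>f. bij_betw f (verts G) (verts H) \<and> edges H = (\<lambda>e. f ` e) ` edges G)"

definition copy_in :: "'b ugraph \<Rightarrow> 'a ugraph \<Rightarrow> 'a ugraph \<Rightarrow> bool" where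
  "copy_in G F S \<longleftrightarrow> subgraph S F \<and> isomorphic S G"

definition complete_bipartite :: "nat \<Rightarrow> nat \<Rightarrow> (nat + nat) ugraph" where
  "complete_bipartite a b =
     \<lparr>verts = {..<a} <+> {..<b}, edges = {{Inl i, Inr j} | i j. i < a \<and> j < b}\<rparr>"

lemma simple_graph_complete_bipartite: "simple_graph (complete_bipartite a b)"
  by (auto simp: simple_graph_def complete_bipartite_def)

definition exact_edge_coloring :: "nat \<Rightarrow> 'a ugraph \<Rightarrow> ('a set \<Rightarrow> nat) \<Rightarrow> bool" where
  "exact_edge_coloring k F c \<longleftrightarrow> c ` edges F = {1..k}"

definition rainbow :: "('a set \<Rightarrow> nat) \<Rightarrow> 'a ugraph \<Rightarrow> bool" where
  "rainbow c S \<longleftrightarrow> inj_on c (edges S)"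

definition monochromatic :: "('a set \<Rightarrow> nat) \<Rightarrow> 'a ugraph \<Rightarrow> bool" where
  "monochromatic c S \<longleftrightarrow> (\<forall>e\<in>edges S. \<forall>e'\<in>edges S. c e = c e')"

definition bgr_bound :: "nat \<Rightarrow> 'a ugraph \<Rightarrow> 'b ugraph \<Rightarrow> nat \<Rightarrow> bool" where
  "bgr_bound k G H n \<longleftrightarrow>
     k \<le> n\<^sup>2 \<and>
     (\<forall>N\<ge>n. \<forall>c. exact_edge_coloring k (complete_bipartite N N) c \<longrightarrow>
        (\<exists>S. copy_in G (complete_bipartite N N) S \<and> rainbow c S) \<or>
        (\<exists>S. copy_in H (complete_bipartite N N) S \<and> monochromatic c S))"

text \<open>The infimum in \<^typ>\<open>enat\<close> of the empty set is \<open>\<infinity>\<close>, so a finite value of \<open>bgr\<close>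
  is an attained minimum.\<close>

definition bgr :: "nat \<Rightarrow> 'a ugraph \<Rightarrow> 'b ugraph \<Rightarrow> enat" where
  "bgr k G H = Inf {enat n | n. bgr_bound k G H n}"

lemma bgr_eq_enat_iff:
  "bgr k G H = enat m \<longleftrightarrow> bgr_bound k G H m \<and> (\<forall>n. bgr_bound k G H n \<longrightarrow> m \<le> n)"
  (is "?l \<longleftrightarrow> ?r")
proof
  let ?S = "{enat n | n. bgr_bound k G H n}"
  assume l: ?l
  then have "?S \<noteq> {}"
    unfolding bgr_def Inf_enat_def by (metis enat.distinct(1))
  then have "Inf ?S \<in> ?S"
    by (metis (no_types, lifting) Inf_enat_def LeastI ex_in_conv)
  then have "bgr_bound k G H m"
    using l by (auto simp: bgr_def)
  moreover have "m \<le> n" if "bgr_bound k G H n" for n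
  proof -
    have "Inf ?S \<le> enat n"
      using that by (intro Inf_lower) blast
    then show ?thesis
      using l by (simp add: bgr_def)
  qed
  ultimately show ?r
    by blast
next
  assume ?r
  then show ?l
    unfolding bgr_def by (intro antisym Inf_lower Inf_greatest) auto
qed

end

theory Submission
  imports Defs
begin

text \<open>
  Call the set of colours on the edges at a vertex its \<^emph>\<open>palette\<close>. A copy of a star in
  \<open>K\<^bsub>N,N\<^esub>\<close> is a vertex together with a set of vertices on the other side, so a colouring
  without a rainbow \<open>K\<^bsub>1,3\<^esub>\<close> is one in which every palette has at most two colours, and a
  colouring without a monochromatic \<open>K\<^bsub>1,t\<^esub>\<close> is one in which every colour occurs fewer than
  \<open>t\<close> times at every vertex.

  For the upper bound, suppose that such a colouring of \<open>K\<^bsub>N,N\<^esub>\<close> with \<open>N \<ge> t + 1\<close> has at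
  least \<open>t \<ge> 5\<close> colours. The colour of an edge lies in the palettes of both ends. Hence each
  left palette meets each right palette, and the palettes of either side cover all colours.
  This is rigid: two disjoint palettes on one side would confine the other side to their four
  colours, so the palettes of one side pairwise intersect; being sets of size at most two that
  cover at least four colours they form a star and not a triangle, and its centre \<open>a\<close> lies in
  every palette on both sides (\<open>cross_intersecting_common_element\<close>). Now let \<open>x \<noteq> a\<close> be a
  colour and take a left vertex that sees it. This vertex has fewer than \<open>t\<close> edges of colour
  \<open>a\<close>, and all its other edges have colour \<open>x\<close>, so at least \<open>N - t + 1\<close> right vertices have
  palette \<open>{a, x}\<close>. Different \<open>x\<close> need different right vertices, so
  \<open>(t - 1) (N - t + 1) \<le> N\<close>, which fails for \<open>N > t \<ge> 5\<close> (\<open>matrix_colouring_bound\<close>).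

  For the lower bound, colour a perfect matching of \<open>K\<^bsub>t,t\<^esub>\<close> with \<open>k - 1 \<le> t\<close> colours and
  all other edges with one further colour. The \<open>t\<close> edges at a vertex then show exactly two
  colours, so neither star occurs.
\<close>

section \<open>Stars in complete bipartite graphs\<close>

definition matrix_of_colouring :: "((nat + nat) set \<Rightarrow> nat) \<Rightarrow> nat \<Rightarrow> nat \<Rightarrow> nat" where
  "matrix_of_colouring c i j = c {Inl i, Inr j}"

text \<open>
  The preimages of an edge under the two injections are singletons holding its left and its
  right end; on sets that are not edges the value is arbitrary.
\<close>

definition colouring_of_matrix :: "(nat \<Rightarrow> nat \<Rightarrow> nat) \<Rightarrow> (nat + nat) set \<Rightarrow> nat" where
  "colouring_of_matrix M e = M (the_elem (Inl -` e)) (the_elem (Inr -` e))"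

lemma matrix_of_colouring_of_matrix [simp]: "matrix_of_colouring (colouring_of_matrix M) = M"
proof (intro ext)
  fix i j :: nat
  have "Inl -` {Inl i, Inr j :: nat + nat} = {i}" "Inr -` {Inl i, Inr j :: nat + nat} = {j}"
    by auto
  then show "matrix_of_colouring (colouring_of_matrix M) i j = M i j"
    by (simp add: matrix_of_colouring_def colouring_of_matrix_def)
qed

lemma exact_edge_coloring_iff_matrix:
  "exact_edge_coloring k (complete_bipartite N N) c \<longleftrightarrow>
     {matrix_of_colouring c i j | i j. i < N \<and> j < N} = {1..k}"
proof -
  have "c ` edges (complete_bipartite N N) = {matrix_of_colouring c i j | i j. i < N \<and> j < N}"
    by (auto simp: complete_bipartite_def matrix_of_colouring_def)
  then show ?thesis
    by (simp add: exact_edge_coloring_def)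
qed

lemma edges_complete_bipartite_1:
  "edges (complete_bipartite 1 m) = (\<lambda>w. {Inl 0, w}) ` Inr ` {..<m}"
  by (auto simp: complete_bipartite_def)

lemma verts_complete_bipartite_1:
  "verts (complete_bipartite 1 m) = insert (Inl 0) (Inr ` {..<m})"
  by (auto simp: complete_bipartite_def)

lemma isomorphic_star:
  assumes "v \<notin> W" "finite W" "card W = m"
  shows "isomorphic \<lparr>verts = insert v W, edges = (\<lambda>w. {v, w}) ` W\<rparr> (complete_bipartite 1 m)"
proof -
  obtain h where h: "bij_betw h W {..<m}"
    using assms ex_bij_betw_finite_nat[of W] by (auto simp: atLeast0LessThan)
  define f where "f = (\<lambda>x. if x = v then Inl (0::nat) else Inr (h x))"
  have on_W: "f w = Inr (h w)" if "w \<in> W" for w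
    using that assms(1) by (auto simp: f_def)
  have "f ` W = Inr ` {..<m}"
    using on_W bij_betw_imp_surj_on[OF h] by (metis (no_types, lifting) image_cong image_image)
  moreover have "inj_on f W"
    using bij_betw_imp_inj_on[OF h] on_W by (auto simp: inj_on_def)
  moreover have "f v = Inl 0"
    by (simp add: f_def)
  ultimately have "bij_betw f (insert v W) (verts (complete_bipartite 1 m))"
    unfolding verts_complete_bipartite_1 bij_betw_def using assms(1)
    by (simp add: image_iff)
  moreover have "edges (complete_bipartite 1 m) = (\<lambda>e. f ` e) ` (\<lambda>w. {v, w}) ` W"
    unfolding edges_complete_bipartite_1 \<open>f ` W = _\<close>[symmetric]
    using \<open>f v = _\<close> by (auto simp: image_image)
  ultimately show ?thesis
    by (auto simp: isomorphic_def)
qed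

lemma isomorphic_starE:
  assumes "isomorphic S (complete_bipartite 1 m)" "simple_graph S"
  obtains v W where "v \<in> verts S" "W \<subseteq> verts S" "finite W" "card W = m"
    "edges S = (\<lambda>w. {v, w}) ` W"
proof -
  obtain f where f: "bij_betw f (verts S) (verts (complete_bipartite 1 m))"
    and e: "edges (complete_bipartite 1 m) = (\<lambda>e. f ` e) ` edges S"
    using assms(1) by (auto simp: isomorphic_def)
  define g where "g = inv_into (verts S) f"
  have g: "bij_betw g (verts (complete_bipartite 1 m)) (verts S)"
    unfolding g_def by (rule bij_betw_inv_into[OF f])
  have gf: "g ` f ` x = x" if "x \<in> edges S" for x
  proof -
    have "x \<subseteq> verts S"
      using assms(2) that by (auto simp: simple_graph_def)
    then show ?thesis
      unfolding g_def using f by (metis bij_betw_def inv_into_image_cancel)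
  qed
  have "edges S = (\<lambda>x. g ` x) ` edges (complete_bipartite 1 m)"
    unfolding e using gf by (auto simp: image_image)
  then have "edges S = (\<lambda>w. {g (Inl 0), w}) ` g ` Inr ` {..<m}"
    unfolding edges_complete_bipartite_1 by (auto simp: image_image)
  moreover have "g (Inl 0) \<in> verts S" "g ` Inr ` {..<m} \<subseteq> verts S"
    using bij_betw_imp_surj_on[OF g] unfolding verts_complete_bipartite_1 by auto
  moreover have "card (g ` Inr ` {..<m}) = m"
  proof -
    have "inj_on g (Inr ` {..<m})"
      using bij_betw_imp_inj_on[OF g] unfolding verts_complete_bipartite_1
      by (rule inj_on_subset) auto
    then show ?thesis
      by (simp add: card_image)
  qed
  ultimately show ?thesis
    by (intro that[of "g (Inl 0)" "g ` Inr ` {..<m}"]) simp_all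
qed

text \<open>
  A property \<open>Q\<close> of the edge set stands for being rainbow and for being monochromatic alike.
  All leaves lie on one side because the edges join them to the centre.
\<close>

lemma star_copy_iff:
  "(\<exists>S. copy_in (complete_bipartite 1 m) (complete_bipartite N N) S \<and> Q (edges S)) \<longleftrightarrow>
     (\<exists>i<N. \<exists>J\<subseteq>{..<N}. card J = m \<and> Q ((\<lambda>j. {Inl i, Inr j}) ` J)) \<or>
     (\<exists>j<N. \<exists>I\<subseteq>{..<N}. card I = m \<and> Q ((\<lambda>i. {Inl i, Inr j}) ` I))"
  (is "?copy \<longleftrightarrow> ?left \<or> ?right")
proof
  assume ?copy
  then obtain S where sub: "subgraph S (complete_bipartite N N)"
    and iso: "isomorphic S (complete_bipartite 1 m)" and Q: "Q (edges S)"
    by (auto simp: copy_in_def)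
  have "simple_graph S"
    using sub by (simp add: subgraph_def)
  from isomorphic_starE[OF iso this] obtain v W where vW: "v \<in> verts S" "W \<subseteq> verts S"
    "finite W" "card W = m" and e: "edges S = (\<lambda>w. {v, w}) ` W"
    by metis
  have v: "v \<in> {..<N} <+> {..<N}"
    using vW(1) sub by (auto simp: subgraph_def complete_bipartite_def)
  have edge: "{v, w} \<in> edges (complete_bipartite N N)" if "w \<in> W" for w
    using that e sub by (auto simp: subgraph_def)
  from v show "?left \<or> ?right"
  proof (rule PlusE)
    fix i assume i: "i \<in> {..<N}" "v = Inl i"
    have "W \<subseteq> Inr ` {..<N}"
      using edge i by (auto simp: complete_bipartite_def doubleton_eq_iff)
    then obtain J where J: "J \<subseteq> {..<N}" "W = Inr ` J"
      by (metis subset_imageE)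
    have "card J = m"
      using vW(4) J(2) by (simp add: card_image)
    then show ?thesis
      using i J Q unfolding e by (auto simp: image_image)
  next
    fix j assume j: "j \<in> {..<N}" "v = Inr j"
    have "W \<subseteq> Inl ` {..<N}"
      using edge j by (auto simp: complete_bipartite_def doubleton_eq_iff)
    then obtain I where I: "I \<subseteq> {..<N}" "W = Inl ` I"
      by (metis subset_imageE)
    have "card I = m"
      using vW(4) I(2) by (simp add: card_image)
    then show ?thesis
      using j I Q unfolding e by (auto simp: image_image insert_commute)
  qed
next
  have star: ?copy if "v \<notin> W" "finite W" "card W = m"
    "insert v W \<subseteq> verts (complete_bipartite N N)"
    "(\<lambda>w. {v, w}) ` W \<subseteq> edges (complete_bipartite N N)" "Q ((\<lambda>w. {v, w}) ` W)" for v W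
    using isomorphic_star[OF that(1-3)] that
    by (intro exI[of _ "\<lparr>verts = insert v W, edges = (\<lambda>w. {v, w}) ` W\<rparr>"])
      (auto simp: copy_in_def subgraph_def simple_graph_def card_insert_if)
  assume "?left \<or> ?right"
  then show ?copy
  proof
    assume ?left
    then obtain i J where *: "i < N" "J \<subseteq> {..<N}" "card J = m" "Q ((\<lambda>j. {Inl i, Inr j}) ` J)"
      by auto
    then show ?copy
      by (intro star[of "Inl i" "Inr ` J"])
        (auto simp: card_image image_image complete_bipartite_def finite_subset)
  next
    assume ?right
    then obtain j I where *: "j < N" "I \<subseteq> {..<N}" "card I = m" "Q ((\<lambda>i. {Inl i, Inr j}) ` I)"
      by auto
    then show ?copy
      by (intro star[of "Inr j" "Inl ` I"])
        (auto simp: card_image image_image complete_bipartite_def finite_subset insert_commute)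
  qed
qed

lemma rainbow_star_iff:
  fixes c :: "(nat + nat) set \<Rightarrow> nat"
  defines "M \<equiv> matrix_of_colouring c"
  shows "(\<exists>S. copy_in (complete_bipartite 1 m) (complete_bipartite N N) S \<and> rainbow c S) \<longleftrightarrow>
    (\<exists>i<N. m \<le> card (M i ` {..<N})) \<or> (\<exists>j<N. m \<le> card ((\<lambda>i. M i j) ` {..<N}))"
proof -
  have large_image: "(\<exists>J\<subseteq>{..<N}. card J = m \<and> inj_on f J) \<longleftrightarrow> m \<le> card (f ` {..<N})"
    for f :: "nat \<Rightarrow> nat"
  proof
    assume "\<exists>J\<subseteq>{..<N}. card J = m \<and> inj_on f J"
    then show "m \<le> card (f ` {..<N})"
      by (metis card_image card_mono finite_imageI finite_lessThan image_mono)
  next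
    assume "m \<le> card (f ` {..<N})"
    then obtain T where "T \<subseteq> f ` {..<N}" "card T = m"
      by (metis obtain_subset_with_card_n)
    then show "\<exists>J\<subseteq>{..<N}. card J = m \<and> inj_on f J"
      by (metis card_image subset_image_inj)
  qed
  have row: "inj_on c ((\<lambda>j. {Inl i, Inr j}) ` J) \<longleftrightarrow> inj_on (M i) J" for i J
    by (auto simp: inj_on_def M_def matrix_of_colouring_def doubleton_eq_iff)
  have column: "inj_on c ((\<lambda>i. {Inl i, Inr j}) ` I) \<longleftrightarrow> inj_on (\<lambda>i. M i j) I" for j I
    by (auto simp: inj_on_def M_def matrix_of_colouring_def doubleton_eq_iff)
  show ?thesis
    unfolding rainbow_def star_copy_iff[of m N "inj_on c"] row column large_image ..
qed

lemma monochromatic_star_iff: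
  fixes c :: "(nat + nat) set \<Rightarrow> nat"
  defines "M \<equiv> matrix_of_colouring c"
  assumes "m > 0"
  shows "(\<exists>S. copy_in (complete_bipartite 1 m) (complete_bipartite N N) S \<and> monochromatic c S) \<longleftrightarrow>
    (\<exists>i<N. \<exists>x. m \<le> card {j. j < N \<and> M i j = x}) \<or>
    (\<exists>j<N. \<exists>x. m \<le> card {i. i < N \<and> M i j = x})"
proof -
  have large_fibre: "(\<exists>J\<subseteq>{..<N}. card J = m \<and> (\<forall>j\<in>J. \<forall>j'\<in>J. f j = f j')) \<longleftrightarrow>
    (\<exists>x. m \<le> card {j. j < N \<and> f j = x})" for f :: "nat \<Rightarrow> nat"
  proof
    assume "\<exists>J\<subseteq>{..<N}. card J = m \<and> (\<forall>j\<in>J. \<forall>j'\<in>J. f j = f j')"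
    then obtain J where J: "J \<subseteq> {..<N}" "card J = m" "\<forall>j\<in>J. \<forall>j'\<in>J. f j = f j'"
      by blast
    with \<open>m > 0\<close> obtain j where "j \<in> J"
      by fastforce
    with J have "J \<subseteq> {j'. j' < N \<and> f j' = f j}"
      by blast
    then have "m \<le> card {j'. j' < N \<and> f j' = f j}"
      using J(2) card_mono[of "{j'. j' < N \<and> f j' = f j}" J] by simp
    then show "\<exists>x. m \<le> card {j. j < N \<and> f j = x}"
      by blast
  next
    assume "\<exists>x. m \<le> card {j. j < N \<and> f j = x}"
    then obtain x J where "J \<subseteq> {j. j < N \<and> f j = x}" "card J = m"
      by (metis obtain_subset_with_card_n)
    then show "\<exists>J\<subseteq>{..<N}. card J = m \<and> (\<forall>j\<in>J. \<forall>j'\<in>J. f j = f j')"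
      by (intro exI[of _ J]) auto
  qed
  show ?thesis
    unfolding monochromatic_def
      star_copy_iff[of m N "\<lambda>E. \<forall>e\<in>E. \<forall>e'\<in>E. c e = c e'"] ball_simps
      large_fibre[symmetric]
    by (simp add: M_def matrix_of_colouring_def)
qed

section \<open>Palettes of at most two colours\<close>

text \<open>
  Two disjoint members of \<open>\<A>\<close> would confine \<open>\<Union>\<B>\<close> to their at most four elements, so \<open>\<A>\<close> is
  pairwise intersecting. Since \<open>\<A>\<close> covers many elements, it has members \<open>A1\<close>, then \<open>A2\<close> with an
  element \<open>x\<close> outside \<open>A1\<close>, then \<open>A3\<close> with an element \<open>y\<close> outside \<open>A1\<close> and different from \<open>x\<close>.
  They share an element \<open>a\<close>, and a set that misses \<open>a\<close> but meets all three would contain \<open>x\<close>,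
  \<open>y\<close> and an element of \<open>A1\<close>, which is too many.
\<close>

lemma cross_intersecting_common_element:
  fixes \<A> \<B> :: "'a set set"
  assumes small: "\<And>S. S \<in> \<A> \<union> \<B> \<Longrightarrow> finite S \<and> card S \<le> 2"
    and cross: "\<And>A B. A \<in> \<A> \<Longrightarrow> B \<in> \<B> \<Longrightarrow> A \<inter> B \<noteq> {}"
    and cover: "card (\<Union>\<A>) \<ge> 5" "card (\<Union>\<B>) \<ge> 5"
  obtains a where "\<And>S. S \<in> \<A> \<union> \<B> \<Longrightarrow> a \<in> S"
proof -
  have three: False if "x \<in> S" "y \<in> S" "z \<in> S" "x \<noteq> y" "x \<noteq> z" "y \<noteq> z" "S \<in> \<A> \<union> \<B>"
    for x y z S
  proof -
    have "card {x, y, z} \<le> card S"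
      using that small[OF that(7)] by (intro card_mono) auto
    then show False
      using that small[OF that(7)] by simp
  qed
  have meet: "A \<inter> S \<noteq> {}" if "A \<in> \<A>" "S \<in> \<A> \<union> \<B>" for A S
  proof
    assume disj: "A \<inter> S = {}"
    with cross that have "S \<in> \<A>"
      by blast
    have "B \<subseteq> A \<union> S" if B: "B \<in> \<B>" for B
    proof
      fix x assume "x \<in> B"
      obtain p q where "p \<in> A \<inter> B" "q \<in> S \<inter> B"
        using cross[OF \<open>A \<in> \<A>\<close> B] cross[OF \<open>S \<in> \<A>\<close> B] by blast
      then show "x \<in> A \<union> S"
        using three[of x B p q] disj B \<open>x \<in> B\<close> by blast
    qed
    then have "card (\<Union>\<B>) \<le> card (A \<union> S)"
      using small \<open>A \<in> \<A>\<close> \<open>S \<in> \<A>\<close> by (intro card_mono) auto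
    also have "\<dots> \<le> card A + card S"
      by (rule card_Un_le)
    also have "\<dots> \<le> 4"
      using small[of A] small[of S] \<open>A \<in> \<A>\<close> \<open>S \<in> \<A>\<close> by simp
    finally show False
      using cover(2) by simp
  qed
  have outside: "\<exists>A\<in>\<A>. \<exists>x\<in>A. x \<notin> T" if "card T \<le> 4" "finite T" for T
  proof (rule ccontr)
    assume "\<not> ?thesis"
    then have "card (\<Union>\<A>) \<le> card T"
      using that by (intro card_mono) auto
    then show False
      using cover(1) that by simp
  qed
  obtain A1 where A1: "A1 \<in> \<A>"
    using outside[of "{}"] by auto
  obtain A2 x where A2: "A2 \<in> \<A>" "x \<in> A2" "x \<notin> A1"
    using outside[of A1] small[of A1] A1 by auto
  obtain a where a: "a \<in> A1" "a \<in> A2"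
    using meet[of A1 A2] A1 A2 by blast
  have "card (A1 \<union> {x}) \<le> 4" "finite (A1 \<union> {x})"
    using small[of A1] A1 card_Un_le[of A1 "{x}"] by auto
  from outside[OF this] obtain A3 y where A3: "A3 \<in> \<A>" "y \<in> A3" "y \<notin> A1" "y \<noteq> x"
    by auto
  have "a \<in> A3"
  proof (rule ccontr)
    assume "a \<notin> A3"
    \<comment> \<open>Without \<open>a\<close>, the set \<open>A3\<close> meets \<open>A2 = {a, x}\<close> in \<open>x\<close>, and then it contains \<open>x\<close>, \<open>y\<close>
      and an element of \<open>A1\<close>.\<close>
    obtain p q where pq: "p \<in> A1 \<inter> A3" "q \<in> A2 \<inter> A3"
      using meet[of A1 A3] meet[of A2 A3] A1 A2 A3 by blast
    have "q = x"
      using three[of q A2 a x] pq A2 a \<open>a \<notin> A3\<close> by blast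
    then show False
      using three[of p A3 q y] pq A2 A3 by blast
  qed
  have "a \<in> S" if S: "S \<in> \<A> \<union> \<B>" for S
  proof (rule ccontr)
    assume "a \<notin> S"
    obtain p q r where pqr: "p \<in> A1 \<inter> S" "q \<in> A2 \<inter> S" "r \<in> A3 \<inter> S"
      using meet[of A1 S] meet[of A2 S] meet[of A3 S] A1 A2 A3 S by blast
    have "q = x"
      using three[of q A2 a x] pqr A2 a \<open>a \<notin> S\<close> by blast
    moreover have "r = y"
      using three[of r A3 a y] pqr A3 a \<open>a \<in> A3\<close> \<open>a \<notin> S\<close> by blast
    ultimately show False
      using three[of p S q r] pqr S A2 A3 by blast
  qed
  then show ?thesis
    using that by blast
qed

text \<open>
  The centre \<open>a\<close> is the background colour. Each further colour \<open>x\<close> owns the set \<open>R x\<close> of columns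
  that contain it. These sets are disjoint, and each is large because a row with colour \<open>x\<close> has
  few entries \<open>a\<close>.
\<close>

lemma matrix_colouring_bound:
  fixes M :: "nat \<Rightarrow> nat \<Rightarrow> nat"
  assumes k: "k \<ge> 5"
    and colours: "{M i j | i j. i < N \<and> j < N} = {1..k}"
    and rows: "\<And>i. i < N \<Longrightarrow> card (M i ` {..<N}) \<le> 2"
    and columns: "\<And>j. j < N \<Longrightarrow> card ((\<lambda>i. M i j) ` {..<N}) \<le> 2"
    and sparse: "\<And>i x. i < N \<Longrightarrow> card {j. j < N \<and> M i j = x} < t"
  shows "(k - 1) * (N + 1 - t) \<le> N"
proof -
  define L where "L i = M i ` {..<N}" for i
  define C where "C j = (\<lambda>i. M i j) ` {..<N}" for j
  have "\<Union>(L ` {..<N}) = {M i j | i j. i < N \<and> j < N}"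
    "\<Union>(C ` {..<N}) = {M i j | i j. i < N \<and> j < N}"
    by (auto simp: L_def C_def)
  then have cover: "card (\<Union>(L ` {..<N})) \<ge> 5" "card (\<Union>(C ` {..<N})) \<ge> 5"
    using colours k by auto
  have small: "finite S \<and> card S \<le> 2" if "S \<in> L ` {..<N} \<union> C ` {..<N}" for S
    using that rows columns by (auto simp: L_def C_def)
  have cross: "A \<inter> B \<noteq> {}" if "A \<in> L ` {..<N}" "B \<in> C ` {..<N}" for A B
    using that by (auto simp: L_def C_def)
  obtain a where "\<And>S. S \<in> L ` {..<N} \<union> C ` {..<N} \<Longrightarrow> a \<in> S"
    using cross_intersecting_common_element[OF small cross cover] by metis
  then have a: "i < N \<Longrightarrow> a \<in> L i" "i < N \<Longrightarrow> a \<in> C i" for i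
    by auto
  have pair: "x = y" if "x \<in> S" "y \<in> S" "x \<noteq> a" "y \<noteq> a" "S \<in> L ` {..<N} \<union> C ` {..<N}"
    for x y S
  proof (rule ccontr)
    assume "x \<noteq> y"
    have "card {a, x, y} \<le> card S"
      using that a small[OF that(5)] by (intro card_mono) auto
    then show False
      using \<open>x \<noteq> y\<close> that small[OF that(5)] by simp
  qed
  define R where "R x = {j. j < N \<and> x \<in> C j}" for x
  have large: "N + 1 - t \<le> card (R x)" if x: "x \<in> {1..k} - {a}" for x
  proof -
    have "x \<in> {M i j | i j. i < N \<and> j < N}"
      using x unfolding colours by blast
    then obtain i where i: "i < N" "x \<in> L i"
      by (auto simp: L_def)
    have "j \<in> {j. j < N \<and> M i j = a} \<union> R x" if j: "j < N" for j
    proof (cases "M i j = a")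
      case False
      have "M i j \<in> L i"
        using j by (auto simp: L_def)
      then have "M i j = x"
        using pair[of "M i j" "L i" x] i x False by blast
      then have "x \<in> C j"
        using i by (auto simp: C_def)
      then show ?thesis
        using j by (simp add: R_def)
    qed (use j in simp)
    then have "card {..<N} \<le> card ({j. j < N \<and> M i j = a} \<union> R x)"
      by (intro card_mono) (auto simp: R_def)
    also have "\<dots> \<le> card {j. j < N \<and> M i j = a} + card (R x)"
      by (rule card_Un_le)
    finally show ?thesis
      using sparse[OF i(1), of a] by simp
  qed
  have "k - 1 \<le> card ({1..k} - {a})"
    using diff_card_le_card_Diff[of "{a}" "{1..k}"] by simp
  then have "(k - 1) * (N + 1 - t) \<le> card ({1..k} - {a}) * (N + 1 - t)"
    by (rule mult_le_mono1)
  also have "\<dots> = (\<Sum>x\<in>{1..k} - {a}. N + 1 - t)"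
    by simp
  also have "\<dots> \<le> (\<Sum>x\<in>{1..k} - {a}. card (R x))"
    by (intro sum_mono large)
  also have "\<dots> = card (\<Union>x\<in>{1..k} - {a}. R x)"
  proof (rule card_UN_disjoint[symmetric])
    show "\<forall>x\<in>{1..k} - {a}. \<forall>y\<in>{1..k} - {a}. x \<noteq> y \<longrightarrow> R x \<inter> R y = {}"
      using pair unfolding R_def by blast
  qed (auto simp: R_def)
  also have "\<dots> \<le> card {..<N}"
    by (intro card_mono) (auto simp: R_def)
  finally show ?thesis
    by simp
qed

section \<open>The extremal number\<close>

text \<open>
  The minimum lets the last matching edges share the colour \<open>k - 1\<close> when there are fewer than
  \<open>t\<close> matching colours; colour \<open>k\<close> is the one off the matching.
\<close>

lemma matching_matrix_colours:
  fixes t k :: nat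
  assumes "2 \<le> t" "2 \<le> k" "k \<le> t + 1"
  shows "{if i = j then min (i + 1) (k - 1) else k | i j. i < t \<and> j < t} = {1..k}"
proof (intro set_eqI iffI)
  fix x assume "x \<in> {1..k}"
  then consider "x = k" | "1 \<le> x" "x < k"
    by fastforce
  then show "x \<in> {if i = j then min (i + 1) (k - 1) else k | i j. i < t \<and> j < t}"
  proof cases
    case 1
    then show ?thesis
      using assms by (intro CollectI exI[of _ 0] exI[of _ 1]) auto
  next
    case 2
    then show ?thesis
      using assms by (intro CollectI exI[of _ "x - 1"]) auto
  qed
qed (use assms in \<open>auto split: if_splits\<close>)

theorem theorem4p1:
  fixes t k :: nat
  assumes "t \<ge> 5" and "t \<le> k" and "k \<le> t + 1"
  shows "bgr k (complete_bipartite 1 3) (complete_bipartite 1 t) = enat (t + 1)"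
proof -
  have t: "t > 0"
    using assms by simp
  have "bgr_bound k (complete_bipartite 1 3) (complete_bipartite 1 t) (t + 1)"
    unfolding bgr_bound_def
  proof (intro conjI allI impI)
    show "k \<le> (t + 1)\<^sup>2"
      using assms by (simp add: power2_eq_square)
  next
    fix N c
    assume N: "N \<ge> t + 1" and exact: "exact_edge_coloring k (complete_bipartite N N) c"
    define M where "M = matrix_of_colouring c"
    show "(\<exists>S. copy_in (complete_bipartite 1 3) (complete_bipartite N N) S \<and> rainbow c S) \<or>
      (\<exists>S. copy_in (complete_bipartite 1 t) (complete_bipartite N N) S \<and> monochromatic c S)"
    proof (rule ccontr)
      assume none: "\<not> ?thesis"
      have "(k - 1) * (N + 1 - t) \<le> N"
      proof (rule matrix_colouring_bound)
        show "5 \<le> k"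
          using assms by simp
        show "{M i j | i j. i < N \<and> j < N} = {1..k}"
          using exact unfolding exact_edge_coloring_iff_matrix M_def .
        show "card (M i ` {..<N}) \<le> 2" if "i < N" for i
          using none that unfolding rainbow_star_iff M_def by force
        show "card ((\<lambda>i. M i j) ` {..<N}) \<le> 2" if "j < N" for j
          using none that unfolding rainbow_star_iff M_def by force
        show "card {j. j < N \<and> M i j = x} < t" if "i < N" for i x
          using none that unfolding monochromatic_star_iff[OF t] M_def by (meson not_le)
      qed
      \<comment> \<open>With \<open>N = t + 1 + s\<close> and \<open>k = 5 + r\<close> the bound expands to
        \<open>8 + 4 * s + 2 * r + r * s \<le> t + 1 + s\<close>, whereas \<open>t + 1 \<le> 6 + r\<close>.\<close>
      moreover obtain s where "N = t + 1 + s"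
        using N le_Suc_ex by blast
      moreover obtain r where "k = 5 + r" "t \<le> k"
        using assms le_Suc_ex[of 5 k] by auto
      ultimately have "(4 + r) * (s + 2) \<le> t + 1 + s" "t \<le> 5 + r"
        by (simp_all add: algebra_simps)
      then show False
        by (simp add: algebra_simps)
    qed
  qed
  moreover have "t + 1 \<le> n"
    if bound: "bgr_bound k (complete_bipartite 1 3) (complete_bipartite 1 t) n" for n
  proof (rule ccontr)
    assume "\<not> t + 1 \<le> n"
    then have "n \<le> t"
      by simp
    define M where "M i j = (if i = j then min (i + 1) (k - 1) else k)" for i j
    define c where "c = colouring_of_matrix M"
    have M: "matrix_of_colouring c = M"
      by (simp add: c_def)
    have "exact_edge_coloring k (complete_bipartite t t) c"
      unfolding exact_edge_coloring_iff_matrix M M_def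
      using matching_matrix_colours[of t k] assms by simp
    then consider (rainbow)
        "\<exists>S. copy_in (complete_bipartite 1 3) (complete_bipartite t t) S \<and> rainbow c S"
      | (mono) "\<exists>S. copy_in (complete_bipartite 1 t) (complete_bipartite t t) S \<and> monochromatic c S"
      using bound \<open>n \<le> t\<close> unfolding bgr_bound_def by blast
    then show False
    proof cases
      case rainbow
      have two: "\<not> 3 \<le> card (f ` {..<t})"
        if "\<And>j. j < t \<Longrightarrow> f j \<in> {min (i + 1) (k - 1), k}" for f :: "nat \<Rightarrow> nat" and i
      proof -
        have "card (f ` {..<t}) \<le> card {min (i + 1) (k - 1), k}"
          using that by (intro card_mono) auto
        also have "\<dots> \<le> 2"
          by (simp add: card_insert_if)
        finally show ?thesis
          by simp
      qed
      have "\<not> 3 \<le> card (M i ` {..<t})" "\<not> 3 \<le> card ((\<lambda>i'. M i' i) ` {..<t})" for i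
        by (rule two[of _ i]; auto simp: M_def)+
      then show False
        using rainbow unfolding rainbow_star_iff M by blast
    next
      case mono
      have full: "f j = x" if "t \<le> card {j. j < t \<and> f j = x}" "j < t" for f :: "nat \<Rightarrow> nat" and j x
      proof -
        have "{j. j < t \<and> f j = x} = {..<t}"
          using that(1) by (intro card_seteq) auto
        then show ?thesis
          using that(2) by auto
      qed
      have differ: "\<exists>j<t. M i j \<noteq> M i i \<and> M j i \<noteq> M i i" for i
        using assms by (intro exI[of _ "if i = 0 then 1 else 0"]) (auto simp: M_def)
      from mono consider i x where "i < t" "t \<le> card {j. j < t \<and> M i j = x}"
        | j x where "j < t" "t \<le> card {i. i < t \<and> M i j = x}"
        unfolding monochromatic_star_iff[OF t] M by blast
      then show False
      proof cases
        case 1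
        then show False
          using full[OF 1(2)] differ[of i] by metis
      next
        case 2
        then show False
          using full[OF 2(2)] differ[of j] by metis
      qed
    qed
  qed
  ultimately show ?thesis
    unfolding bgr_eq_enat_iff by blast
qed

end
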